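(* For any positive integers $k$ and $q$ and any permutation $\pi$ of $[k-1]$, every $q$-coloring of the edges of the complete graph on vertex set $[R]$ with $R=2^{k^{20q}}$ contains a monochromatic $K_k$ with vertices $a_1<\ldots<a_k$ satisfying $$a_{\pi(1)+1}-a_{\pi(1)}>a_{\pi(2)+1}-a_{\pi(2)}>\ldots>a_{\pi(k-1)+1}-a_{\pi(k-1)}.$$ That is, $R(k;q) \leq 2^{k^{20q}}$.
   Context: For a positive integer $n$, $[n]=\{1,\ldots,n\}$ (and $[0]=\emptyset$). For positive integers $k,q$ and a permutation $\pi$ of $[k-1]$, $R_\pi(k;q)$ denotes the least positive integer $R$ such that every $q$-coloring of the edges of the complete graph on vertex set $[R]$ contains a monochromatic $K_k$ with vertices $a_1<\ldots<a_k$ satisfying $a_{\pi(1)+1}-a_{\pi(1)}>a_{\pi(2)+1}-a_{\pi(2)}>\ldots>a_{\pi(k-1)+1}-a_{\pi(k-1)}$. Moreover $R(k;q)=\max_\pi R_\pi(k;q)$, the maximum being over all permutations $\pi$ of $[k-1]$. *)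

theory Defs
  imports "HOL-Library.Ramsey" "HOL-Combinatorics.Permutations"
begin

definition gap :: "(nat \<Rightarrow> nat) \<Rightarrow> nat \<Rightarrow> nat" where
  "gap a i = a (i + 1) - a i"

(* The edges of the complete graph on V are the 2-subsets of V, i.e. nsets V 2.
   A clique on a 1 < ... < a k is given by its increasing enumeration a, of which only
   the values on {1..k} matter; gap is therefore only applied where the truncated
   subtraction is exact. *)
definition mono_clique_with_gaps ::
  "nat \<Rightarrow> nat \<Rightarrow> (nat \<Rightarrow> nat) \<Rightarrow> nat \<Rightarrow> (nat set \<Rightarrow> nat) \<Rightarrow> (nat \<Rightarrow> nat) \<Rightarrow> bool" where
  "mono_clique_with_gaps k q \<pi> N c a \<longleftrightarrow>
     a ` {1..k} \<subseteq> {1..N} \<and> strict_mono_on {1..k} a \<and>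
     (\<exists>col\<in>{1..q}. \<forall>e\<in>nsets (a ` {1..k}) 2. c e = col) \<and>
     (\<forall>i\<in>{1..<k-1}. gap a (\<pi> i) > gap a (\<pi> (i + 1)))"

definition gap_ramsey :: "nat \<Rightarrow> nat \<Rightarrow> (nat \<Rightarrow> nat) \<Rightarrow> nat \<Rightarrow> bool" where
  "gap_ramsey k q \<pi> N \<longleftrightarrow>
     (\<forall>c \<in> nsets {1..N} 2 \<rightarrow> {1..q}. \<exists>a. mono_clique_with_gaps k q \<pi> N c a)"

definition R_perm :: "(nat \<Rightarrow> nat) \<Rightarrow> nat \<Rightarrow> nat \<Rightarrow> nat" where
  "R_perm \<pi> k q = (LEAST N. N > 0 \<and> gap_ramsey k q \<pi> N)"

definition R_max :: "nat \<Rightarrow> nat \<Rightarrow> nat" where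
  "R_max k q = Max ((\<lambda>\<pi>. R_perm \<pi> k q) ` {\<pi>. \<pi> permutes {1..k-1}})"

end

theory Submission
  imports Defs Complex_Main
begin

text \<open>
  Encode words in \<open>{0,1}\<^sup>M\<close> as numbers with base 4 digits 0 and 1. The gap between two words is
  then governed by the first position where they differ, an earlier position giving a larger gap,
  so it suffices to find monochromatic cliques of words whose consecutive members first differ at
  positions in a prescribed order.

  Colours are removed one at a time. For one colour and \<open>M = 50 k\<^sup>4 (k - 1) h\<close>, either that colour
  contains the required clique, or there is a copy of \<open>{0,1}\<^sup>h\<close> inside \<open>{0,1}\<^sup>M\<close>, respecting first
  differences, which avoids the colour. To see this, cut the positions into \<open>k - 1\<close> blocks, the
  \<open>i\<close>-th largest gap being realised in the \<open>i\<close>-th block. Given a dense set \<open>A\<close> of words, if no two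
  fibres of \<open>A\<close> over prefixes of one block length span many edges of the colour, then order
  shattering and a union bound produce a copy of \<open>{0,1}\<^sup>h\<close> that avoids it. Otherwise take two fibres
  \<open>X\<close>, \<open>Z\<close> with many edges between them. Dependent random choice gives a subset \<open>U\<close> of \<open>X\<close>, still
  dense, in which every set of at most \<open>k\<close> words has a dense common neighbourhood in \<open>Z\<close>. By
  recursion \<open>U\<close> contains the part of the clique to the left of the gap, and the common
  neighbourhood of that part contains the part to the right. The density lost to dependent random
  choice is a small fraction of one block, because the number \<open>t\<close> of sampled vertices and the
  exponent \<open>s\<close> of the common neighbourhoods only need \<open>s t > k M\<close>.
\<close>


subsection \<open>Dependent random choice and transversals\<close>

text \<open>Convexity of the \<open>t\<close>-th power: Bernoulli's inequality, scaled by
  \<open>\<mu> ^ t\<close>, puts the power above its tangent at \<open>\<mu>\<close>. The linear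
  terms of the tangents sum to something nonnegative because the mean of \<open>d\<close> is at
  least \<open>\<mu>\<close>.\<close>

lemma sum_power_ge_card_power:
  fixes d :: "'a \<Rightarrow> real" and \<mu> :: real
  assumes "finite X" "\<And>x. x \<in> X \<Longrightarrow> d x \<ge> 0" "\<mu> > 0" "(\<Sum>x\<in>X. d x) \<ge> card X * \<mu>"
  shows "(\<Sum>x\<in>X. d x ^ t) \<ge> card X * \<mu> ^ t"
proof -
  have "\<mu> ^ t * (1 + t * (d x / \<mu> - 1)) \<le> d x ^ t" if "x \<in> X" for x
  proof -
    have "1 + t * (d x / \<mu> - 1) \<le> (1 + (d x / \<mu> - 1)) ^ t"
      using assms(2)[OF that] assms(3) by (intro Bernoulli_inequality) auto
    hence "\<mu> ^ t * (1 + t * (d x / \<mu> - 1)) \<le> \<mu> ^ t * (d x / \<mu>) ^ t"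
      using assms(3) by (intro mult_left_mono) auto
    thus ?thesis using assms(3) by (simp add: power_divide)
  qed
  hence "(\<Sum>x\<in>X. \<mu> ^ t * (1 + t * (d x / \<mu> - 1))) \<le> (\<Sum>x\<in>X. d x ^ t)"
    by (rule sum_mono)
  moreover have "(\<Sum>x\<in>X. \<mu> ^ t * (1 + t * (d x / \<mu> - 1)))
      = \<mu> ^ t * (card X + t * ((\<Sum>x\<in>X. d x) / \<mu> - card X))"
    by (simp add: sum_distrib_left[symmetric] sum.distrib sum_subtractf sum_divide_distrib)
  moreover have "card X \<le> (\<Sum>x\<in>X. d x) / \<mu>" using assms(3,4) by (simp add: field_simps)
  hence "\<mu> ^ t * card X \<le> \<mu> ^ t * (card X + t * ((\<Sum>x\<in>X. d x) / \<mu> - card X))"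
    using assms(3) by (intro mult_left_mono) auto
  ultimately show ?thesis by (simp add: mult.commute)
qed

text \<open>First moment over a random \<open>t\<close>-tuple from \<open>Z\<close>, drawn with
  repetition; \<open>U\<close> is its common neighbourhood in \<open>X\<close>. By convexity
  \<open>U\<close> contains on average at least a fraction \<open>1 / 2 ^ (c * t)\<close> of
  \<open>X\<close>. The expected number of \<open>m\<close>-tuples in \<open>U\<close> with too few
  common neighbours is at most \<open>card X ^ m / 2 ^ (s * t)\<close>, by \<open>big\<close> less
  than half of that fraction. So some large \<open>U\<close> contains no bad tuple at all.\<close>

lemma dependent_random_choice:
  fixes R :: "'a \<Rightarrow> 'b \<Rightarrow> bool"
  assumes fin: "finite X" "finite Z" and ne: "X \<noteq> {}" "Z \<noteq> {}"
    and dense: "card X * card Z \<le> card {p \<in> X \<times> Z. R (fst p) (snd p)} * 2 ^ c"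
    and big: "card X ^ m * 2 ^ (c * t + 1) < 2 ^ (s * t)"
  obtains U where "U \<subseteq> X" "card X \<le> card U * 2 ^ (c * t + 1)"
    "\<And>xs. length xs = m \<Longrightarrow> set xs \<subseteq> U \<Longrightarrow> card Z \<le> card {z \<in> Z. \<forall>x\<in>set xs. R x z} * 2 ^ s"
proof -
  define N where "N xs = {z \<in> Z. \<forall>x\<in>set xs. R x z}" for xs
  define TT where "TT = {zs. set zs \<subseteq> Z \<and> length zs = t}"
  define U where "U zs = {x \<in> X. \<forall>z\<in>set zs. R x z}" for zs
  define bad where "bad = {xs. set xs \<subseteq> X \<and> length xs = m \<and> card (N xs) * 2 ^ s < card Z}"
  define badT where "badT zs = {xs \<in> bad. set xs \<subseteq> U zs}" for zs
  have finT: "finite TT" and cT: "card TT = card Z ^ t"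
    unfolding TT_def using fin(2) by (auto simp: finite_lists_length_eq card_lists_length_eq)
  have finxs: "finite {xs. set xs \<subseteq> X \<and> length xs = m}" using fin(1) by (rule finite_lists_length_eq)
  have finbad: "finite bad" unfolding bad_def by (rule finite_subset[OF _ finxs]) auto
  have cbad: "card bad \<le> card X ^ m"
    using card_mono[OF finxs, of bad] card_lists_length_eq[OF fin(1)] by (auto simp: bad_def)
  have finN: "finite (N xs)" for xs using fin by (auto simp: N_def)
  have x_pos: "card X > 0" and z_pos: "card Z > 0" using fin ne by (auto simp: card_gt_0_iff)
  have sumU: "(\<Sum>zs\<in>TT. card (U zs)) = (\<Sum>x\<in>X. card (N [x]) ^ t)"
  proof -
    have "(\<Sum>zs\<in>TT. card (U zs)) = (\<Sum>zs\<in>TT. \<Sum>x\<in>X. if \<forall>z\<in>set zs. R x z then 1 else 0)"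
      unfolding U_def using fin by (simp add: sum.If_cases Int_def)
    also have "\<dots> = (\<Sum>x\<in>X. \<Sum>zs\<in>TT. if \<forall>z\<in>set zs. R x z then 1 else 0)"
      by (rule sum.swap)
    also have "\<dots> = (\<Sum>x\<in>X. card (N [x]) ^ t)"
    proof (rule sum.cong[OF refl])
      fix x
      have "TT \<inter> {zs. \<forall>z\<in>set zs. R x z} = {zs. set zs \<subseteq> N [x] \<and> length zs = t}"
        by (auto simp: TT_def N_def)
      thus "(\<Sum>zs\<in>TT. if \<forall>z\<in>set zs. R x z then 1 else 0) = card (N [x]) ^ t"
        using finT finN by (simp add: sum.If_cases card_lists_length_eq)
    qed
    finally show ?thesis .
  qed
  have sumB: "(\<Sum>zs\<in>TT. card (badT zs)) = (\<Sum>xs\<in>bad. card (N xs) ^ t)"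
  proof -
    have "(\<Sum>zs\<in>TT. card (badT zs)) = (\<Sum>zs\<in>TT. \<Sum>xs\<in>bad. if set xs \<subseteq> U zs then 1 else 0)"
      unfolding badT_def using finbad by (simp add: sum.If_cases Int_def)
    also have "\<dots> = (\<Sum>xs\<in>bad. \<Sum>zs\<in>TT. if set xs \<subseteq> U zs then 1 else 0)"
      by (rule sum.swap)
    also have "\<dots> = (\<Sum>xs\<in>bad. card (N xs) ^ t)"
    proof (rule sum.cong[OF refl])
      fix xs assume "xs \<in> bad"
      hence "TT \<inter> {zs. set xs \<subseteq> U zs} = {zs. set zs \<subseteq> N xs \<and> length zs = t}"
        by (auto simp: TT_def N_def U_def bad_def)
      thus "(\<Sum>zs\<in>TT. if set xs \<subseteq> U zs then 1 else 0) = card (N xs) ^ t"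
        using finT finN by (simp add: sum.If_cases card_lists_length_eq)
    qed
    finally show ?thesis .
  qed
  have sumd: "(\<Sum>x\<in>X. card (N [x])) = card {p \<in> X \<times> Z. R (fst p) (snd p)}"
  proof -
    have "{p \<in> X \<times> Z. R (fst p) (snd p)} = (SIGMA x:X. N [x])" by (auto simp: N_def)
    thus ?thesis using fin finN by simp
  qed
  define \<mu> where "\<mu> = real (card Z) / 2 ^ c"
  have lowU: "card X * \<mu> ^ t \<le> (\<Sum>zs\<in>TT. real (card (U zs)))"
  proof -
    have "real (card X * card Z) \<le> real ((\<Sum>x\<in>X. card (N [x])) * 2 ^ c)"
      using dense unfolding sumd by (rule of_nat_mono)
    hence "card X * \<mu> \<le> (\<Sum>x\<in>X. real (card (N [x])))"
      by (simp add: \<mu>_def field_simps)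
    hence "card X * \<mu> ^ t \<le> (\<Sum>x\<in>X. real (card (N [x])) ^ t)"
      using fin z_pos by (intro sum_power_ge_card_power) (auto simp: \<mu>_def)
    also have "\<dots> = real (\<Sum>zs\<in>TT. card (U zs))" unfolding sumU by simp
    finally show ?thesis by simp
  qed
  have upB: "(\<Sum>zs\<in>TT. real (card (badT zs))) \<le> card X ^ m * (card Z / 2 ^ s) ^ t"
  proof -
    have "(\<Sum>zs\<in>TT. real (card (badT zs))) = real (\<Sum>xs\<in>bad. card (N xs) ^ t)"
      unfolding sumB[symmetric] by simp
    also have "\<dots> \<le> (\<Sum>xs\<in>bad. (card Z / 2 ^ s) ^ t)"
      unfolding of_nat_sum
    proof (rule sum_mono)
      fix xs assume "xs \<in> bad"
      hence "real (card (N xs) * 2 ^ s) \<le> real (card Z)"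
        by (intro of_nat_mono) (auto simp: bad_def)
      hence "real (card (N xs)) \<le> card Z / 2 ^ s" by (simp add: field_simps)
      thus "real (card (N xs) ^ t) \<le> (card Z / 2 ^ s) ^ t"
        by (simp add: power_mono)
    qed
    also have "\<dots> \<le> card X ^ m * (card Z / 2 ^ s) ^ t"
      using cbad by (simp add: mult_right_mono)
    finally show ?thesis .
  qed
  have "\<exists>zs\<in>TT. badT zs = {} \<and> card X \<le> card (U zs) * 2 ^ (c * t + 1)"
  proof (rule ccontr)
    assume "\<not> ?thesis"
    hence neg: "badT zs \<noteq> {} \<or> card (U zs) * 2 ^ (c * t + 1) < card X" if "zs \<in> TT" for zs
      using that by force
    \<comment> \<open>Both alternatives at once: if a bad tuple exists, the trivial bound
      \<open>card X\<close> is charged to it; otherwise \<open>U zs\<close> is small. Averaging this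
      over \<open>TT\<close> contradicts \<open>lowU\<close> and \<open>upB\<close>.\<close>
    have le: "real (card (U zs)) \<le> card X * card (badT zs) + card X / 2 ^ (c * t + 1)"
      if "zs \<in> TT" for zs
    proof (cases "badT zs = {}")
      case True
      hence "card (U zs) * 2 ^ (c * t + 1) \<le> card X" using neg[OF that] by auto
      hence "real (card (U zs) * 2 ^ (c * t + 1)) \<le> card X" by (rule of_nat_mono)
      thus ?thesis using True by (simp add: field_simps)
    next
      case False
      have "finite (badT zs)" using finbad by (auto simp: badT_def)
      hence 1: "1 \<le> card (badT zs)" using False by (simp add: Suc_le_eq card_gt_0_iff)
      have "card (U zs) \<le> card X * 1" using fin by (auto simp: U_def intro: card_mono)
      also have "\<dots> \<le> card X * card (badT zs)" using 1 by (rule mult_left_mono) simp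
      finally have "real (card (U zs)) \<le> real (card X * card (badT zs))" by (rule of_nat_mono)
      also have "\<dots> \<le> card X * card (badT zs) + card X / 2 ^ (c * t + 1)" by simp
      finally show ?thesis .
    qed
    have "card X * \<mu> ^ t \<le> (\<Sum>zs\<in>TT. card X * card (badT zs) + card X / 2 ^ (c * t + 1))"
      using lowU sum_mono[of TT "\<lambda>zs. real (card (U zs))", OF le] by linarith
    also have "\<dots> = card X * (\<Sum>zs\<in>TT. real (card (badT zs))) + card Z ^ t * (card X / 2 ^ (c * t + 1))"
      by (simp add: sum.distrib sum_distrib_left cT)
    also have "\<dots> \<le> card X * (card X ^ m * (card Z / 2 ^ s) ^ t) + card Z ^ t * (card X / 2 ^ (c * t + 1))"
      using upB by (simp add: mult_left_mono)
    finally have "(card X * card Z ^ t) * (1 / 2 ^ (c * t)) \<le>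
        (card X * card Z ^ t) * (real (card X ^ m) / 2 ^ (s * t) + 1 / 2 ^ (c * t + 1))"
      by (simp add: \<mu>_def power_divide power_mult field_simps)
    moreover have "0 < real (card X * card Z ^ t)" using x_pos z_pos by simp
    ultimately have "1 / 2 ^ (c * t) \<le> real (card X ^ m) / 2 ^ (s * t) + 1 / 2 ^ (c * t + 1)"
      using mult_le_cancel_left_pos by blast
    hence "(1::real) / 2 ^ (c * t + 1) \<le> card X ^ m / 2 ^ (s * t)"
      by (simp add: field_simps)
    hence "real (2 ^ (s * t)) \<le> real (card X ^ m * 2 ^ (c * t + 1))"
      by (simp add: field_simps)
    thus False using big by linarith
  qed
  then obtain zs where zs: "zs \<in> TT" "badT zs = {}" "card X \<le> card (U zs) * 2 ^ (c * t + 1)" by blast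
  show ?thesis
  proof (rule that)
    show "U zs \<subseteq> X" by (auto simp: U_def)
    show "card X \<le> card (U zs) * 2 ^ (c * t + 1)" by fact
    fix xs assume "length xs = m" "set xs \<subseteq> U zs"
    with zs(2) show "card Z \<le> card {z \<in> Z. \<forall>x\<in>set xs. R x z} * 2 ^ s"
      by (auto simp: badT_def bad_def N_def U_def subset_iff not_less)
  qed
qed

text \<open>Union bound over a uniformly random transversal: each ordered pair of indices is bad
  with probability at most \<open>1 / n\<^sup>2\<close>.\<close>

lemma transversal_avoiding:
  fixes B :: "'i \<Rightarrow> 'i \<Rightarrow> 'a \<Rightarrow> 'a \<Rightarrow> bool"
  assumes fin: "finite I" "\<And>i. i \<in> I \<Longrightarrow> finite (X i)" and ne: "\<And>i. i \<in> I \<Longrightarrow> X i \<noteq> {}"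
    and sparse: "\<And>i j. i \<in> I \<Longrightarrow> j \<in> I \<Longrightarrow> i \<noteq> j \<Longrightarrow>
       card {p \<in> X i \<times> X j. B i j (fst p) (snd p)} * (card I)\<^sup>2 \<le> card (X i) * card (X j)"
  shows "\<exists>f. (\<forall>i\<in>I. f i \<in> X i) \<and> (\<forall>i\<in>I. \<forall>j\<in>I. i \<noteq> j \<longrightarrow> \<not> B i j (f i) (f j))"
proof (cases "I = {}")
  case False
  define F where "F = PiE I X"
  define P where "P = {p \<in> I \<times> I. fst p \<noteq> snd p}"
  define bad where "bad p = {f \<in> F. B (fst p) (snd p) (f (fst p)) (f (snd p))}" for p
  define n where "n = card I"
  have n: "n > 0" using False fin by (simp add: n_def card_gt_0_iff)
  have finF: "finite F" unfolding F_def using fin by (intro finite_PiE) auto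
  have F_pos: "card F > 0" using finF ne by (auto simp: card_gt_0_iff F_def PiE_eq_empty_iff)
  have finP: "finite P" using fin by (auto simp: P_def)
  obtain i0 where "i0 \<in> I" using False by blast
  hence "(i0, i0) \<in> I \<times> I - P" by (auto simp: P_def)
  moreover have "P \<subseteq> I \<times> I" by (auto simp: P_def)
  ultimately have "P \<subset> I \<times> I" by blast
  \<comment> \<open>Leaving out the diagonal makes this count strict, so the union bound succeeds
    although sparsity is a weak inequality.\<close>
  hence cP: "card P < n\<^sup>2"
    using psubset_card_mono[of "I \<times> I" P] fin by (simp add: n_def card_cartesian_product power2_eq_square)
  have bad_le: "card (bad p) * n\<^sup>2 \<le> card F" if p: "p \<in> P" for p
  proof -
    obtain i j where ij: "p = (i, j)" "i \<in> I" "j \<in> I" "i \<noteq> j" using p by (auto simp: P_def)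
    define E where "E = {q \<in> X i \<times> X j. B i j (fst q) (snd q)}"
    define G where "G = PiE (I - {i, j}) X"
    have finE: "finite E" unfolding E_def using ij fin by auto
    have finG: "finite G" unfolding G_def using fin by (intro finite_PiE) auto
    \<comment> \<open>A transversal is determined by its values at \<open>i\<close> and
      \<open>j\<close> and its restriction to the other indices, so bad ones number at most
      \<open>card E * card G\<close>.\<close>
    have "inj_on (\<lambda>f. ((f i, f j), restrict f (I - {i, j}))) (bad p)"
    proof (rule inj_onI)
      fix f g assume fg: "f \<in> bad p" "g \<in> bad p"
        and eq: "((f i, f j), restrict f (I - {i, j})) = ((g i, g j), restrict g (I - {i, j}))"
      show "f = g"
      proof (rule PiE_ext)
        show "f \<in> PiE I X" "g \<in> PiE I X" using fg by (auto simp: bad_def F_def)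
        fix x assume "x \<in> I"
        thus "f x = g x" using eq by (cases "x \<in> {i, j}") (auto dest: fun_cong[where x = x])
      qed
    qed
    moreover have "(\<lambda>f. ((f i, f j), restrict f (I - {i, j}))) ` bad p \<subseteq> E \<times> G"
      using ij by (auto simp: bad_def F_def E_def G_def PiE_def Pi_def)
    ultimately have "card (bad p) \<le> card (E \<times> G)"
      using finE finG by (intro card_inj_on_le) auto
    hence "card (bad p) * n\<^sup>2 \<le> card E * n\<^sup>2 * card G"
      by (simp add: card_cartesian_product mult.commute mult.left_commute)
    also have "\<dots> \<le> card (X i) * card (X j) * card G"
      using sparse[OF ij(2-4)] by (intro mult_right_mono) (auto simp: E_def n_def)
    also have "\<dots> = card F"
    proof -
      have "card F = (\<Prod>x\<in>I. card (X x))" unfolding F_def using fin by (simp add: card_PiE)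
      also have "\<dots> = card (X i) * (\<Prod>x\<in>I - {i}. card (X x))"
        using fin ij by (simp add: prod.remove)
      also have "(\<Prod>x\<in>I - {i}. card (X x)) = card (X j) * (\<Prod>x\<in>I - {i} - {j}. card (X x))"
        using fin ij by (intro prod.remove) auto
      also have "I - {i} - {j} = I - {i, j}" by auto
      also have "(\<Prod>x\<in>I - {i, j}. card (X x)) = card G"
        unfolding G_def using fin by (simp add: card_PiE)
      finally show ?thesis by (simp add: mult.assoc)
    qed
    finally show ?thesis .
  qed
  have "card (\<Union>p\<in>P. bad p) * n\<^sup>2 \<le> (\<Sum>p\<in>P. card (bad p)) * n\<^sup>2"
    using finP by (intro mult_right_mono card_UN_le) auto
  also have "\<dots> \<le> (\<Sum>p\<in>P. card F)" unfolding sum_distrib_right using bad_le by (rule sum_mono)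
  also have "\<dots> < n\<^sup>2 * card F" using cP F_pos by simp
  finally have "card (\<Union>p\<in>P. bad p) < card F" using n by (simp add: mult.commute)
  hence "\<not> F \<subseteq> (\<Union>p\<in>P. bad p)"
    using card_mono[of "\<Union>p\<in>P. bad p" F] finP finF by (auto simp: bad_def not_less)
  then obtain f where f: "f \<in> F" "\<And>p. p \<in> P \<Longrightarrow> f \<notin> bad p" by auto
  show ?thesis
  proof (intro exI[of _ f] conjI ballI impI)
    fix i j assume "i \<in> I" "j \<in> I" "i \<noteq> j"
    thus "\<not> B i j (f i) (f j)" using f(2)[of "(i, j)"] f(1) by (auto simp: P_def bad_def)
  qed (use f in \<open>auto simp: F_def\<close>)
qed auto


subsection \<open>Words and their first differences\<close>

text \<open>With words as leaves of the binary tree, \<open>i\<close> is the depth of their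
  branching point and \<open>u\<close> lies to the left. Two distinct words of equal length satisfy
  this in exactly one of the two orders.\<close>

definition meets :: "nat \<Rightarrow> bool list \<Rightarrow> bool list \<Rightarrow> bool" where
  "meets i u v \<longleftrightarrow> i < length u \<and> i < length v \<and> take i u = take i v \<and> \<not> u ! i \<and> v ! i"

definition words :: "nat \<Rightarrow> bool list set" where
  "words n = {u. length u = n}"

lemma words_0 [simp]: "words 0 = {[]}" by (auto simp: words_def)

lemma words_Suc: "words (Suc n) = (#) True ` words n \<union> (#) False ` words n"
  by (auto simp: words_def length_Suc_conv)

lemma words_eq_lists: "words n = {u. set u \<subseteq> UNIV \<and> length u = n}" by (simp add: words_def)

lemma finite_words [simp, intro]: "finite (words n)"
  unfolding words_eq_lists by (rule finite_lists_length_eq) simp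

lemma card_words [simp]: "card (words n) = 2 ^ n"
  unfolding words_eq_lists by (subst card_lists_length_eq) auto

lemma words_nonempty [simp]: "words n \<noteq> {}"
  using Ex_list_of_length by (auto simp: words_def)

lemma meets_0_Cons [simp]: "meets 0 (a # u) (b # v) \<longleftrightarrow> \<not> a \<and> b"
  by (simp add: meets_def)

lemma meets_Suc_Cons [simp]: "meets (Suc i) (a # u) (b # v) \<longleftrightarrow> a = b \<and> meets i u v"
  by (auto simp: meets_def)

lemma meets_append_same: "meets i u v \<Longrightarrow> meets (length y + i) (y @ u) (y @ v)"
  by (simp add: meets_def nth_append)

lemma meets_append: "meets i y z \<Longrightarrow> meets i (y @ u) (z @ v)"
  by (simp add: meets_def nth_append)

lemma meets_neq: "meets i u v \<Longrightarrow> u \<noteq> v" by (auto simp: meets_def)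

text \<open>A level-respecting embedding of binary trees: \<open>g i\<close> depends on the level
  only, not on the node, so comparisons between levels of different pairs survive.\<close>

definition embeds :: "nat \<Rightarrow> nat \<Rightarrow> (nat \<Rightarrow> nat) \<Rightarrow> (bool list \<Rightarrow> bool list) \<Rightarrow> bool" where
  "embeds h M g \<phi> \<longleftrightarrow> (\<forall>i j. i < j \<longrightarrow> j < h \<longrightarrow> g i < g j) \<and> \<phi> ` words h \<subseteq> words M \<and>
     (\<forall>u\<in>words h. \<forall>v\<in>words h. \<forall>i. meets i u v \<longrightarrow> meets (g i) (\<phi> u) (\<phi> v))"

lemma embeds_length: "embeds h M g \<phi> \<Longrightarrow> u \<in> words h \<Longrightarrow> \<phi> u \<in> words M"
  by (auto simp: embeds_def)

lemma embeds_meets: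
  "embeds h M g \<phi> \<Longrightarrow> u \<in> words h \<Longrightarrow> v \<in> words h \<Longrightarrow> meets i u v \<Longrightarrow> meets (g i) (\<phi> u) (\<phi> v)"
  by (auto simp: embeds_def)

lemma embeds_append:
  assumes "embeds h M g \<phi>"
  shows "embeds h (length y + M) (\<lambda>i. length y + g i) (\<lambda>u. y @ \<phi> u)"
  using assms unfolding embeds_def image_subset_iff
  by (auto simp: words_def intro: meets_append_same)

text \<open>Trailing \<open>False\<close> letters identify the smaller cube with a subcube of the
  larger one without moving first differences.\<close>

lemma embeds_pad:
  assumes "embeds h' M g \<phi>" "h \<le> h'"
  shows "embeds h M g (\<lambda>u. \<phi> (u @ replicate (h' - h) False))"
proof -
  have "u @ replicate (h' - h) False \<in> words h'" if "u \<in> words h" for u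
    using that assms(2) by (simp add: words_def)
  thus ?thesis using assms unfolding embeds_def image_subset_iff
    by (simp add: meets_append)
qed

definition free_cube :: "nat \<Rightarrow> nat \<Rightarrow> (bool list \<Rightarrow> bool list \<Rightarrow> bool) \<Rightarrow> bool" where
  "free_cube h M R \<longleftrightarrow> (\<exists>g \<phi>. embeds h M g \<phi> \<and>
     (\<forall>u\<in>words h. \<forall>v\<in>words h. \<forall>i. meets i u v \<longrightarrow> \<not> R (\<phi> u) (\<phi> v)))"

text \<open>Used contrapositively: if there is no free cube in the whole, there is none after fixing
  a prefix \<open>y\<close>.\<close>

lemma free_cube_append:
  assumes "free_cube h M (\<lambda>u v. R (y @ u) (y @ v))"
  shows "free_cube h (length y + M) R"
proof -
  from assms obtain g \<phi> where "embeds h M g \<phi>"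
    "\<forall>u\<in>words h. \<forall>v\<in>words h. \<forall>i. meets i u v \<longrightarrow> \<not> R (y @ \<phi> u) (y @ \<phi> v)"
    by (auto simp: free_cube_def)
  with embeds_append[of h M g \<phi> y] show ?thesis unfolding free_cube_def by blast
qed

subsection \<open>Order shattering\<close>

text \<open>A mask marks the positions at which a binary tree with leaves in \<open>Y\<close> branches, the same
  positions on every path; at an unmarked position each path may choose its own letter.\<close>
fun shatters :: "bool list set \<Rightarrow> bool list \<Rightarrow> bool" where
  "shatters Y [] \<longleftrightarrow> [] \<in> Y"
| "shatters Y (True # m) \<longleftrightarrow> shatters {y. False # y \<in> Y} m \<and> shatters {y. True # y \<in> Y} m"
| "shatters Y (False # m) \<longleftrightarrow> shatters {y. False # y \<in> Y} m \<or> shatters {y. True # y \<in> Y} m"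

text \<open>The position of the \<open>i\<close>-th marked letter, counted from 0. The value at the
  empty mask extends it past the last mark so that it is strictly increasing everywhere.\<close>

fun true_pos :: "bool list \<Rightarrow> nat \<Rightarrow> nat" where
  "true_pos [] i = i"
| "true_pos (False # m) i = Suc (true_pos m i)"
| "true_pos (True # m) 0 = 0"
| "true_pos (True # m) (Suc i) = Suc (true_pos m i)"

lemma true_pos_mono: "i < j \<Longrightarrow> true_pos m i < true_pos m j"
proof (induction m arbitrary: i j)
  case (Cons b m)
  thus ?case by (cases b; cases i; cases j) auto
qed auto

text \<open>The Sauer-Shelah count for order shattering, here an equality. Splitting by first
  letter, masks starting with \<open>True\<close> correspond to \<open>S0 \<inter> S1\<close> and
  those starting with \<open>False\<close> to \<open>S0 \<union> S1\<close>, whose sizes add up to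
  \<open>card S0 + card S1\<close>.\<close>

lemma card_shattered:
  assumes "Y \<subseteq> words r"
  shows "card {m \<in> words r. shatters Y m} = card Y"
  using assms
proof (induction r arbitrary: Y)
  case 0
  hence "Y = {} \<or> Y = {[]}" by auto
  thus ?case by (auto simp: conj_commute cong: conj_cong)
next
  case (Suc r)
  define Y0 where "Y0 = {y. False # y \<in> Y}"
  define Y1 where "Y1 = {y. True # y \<in> Y}"
  have sub: "Y0 \<subseteq> words r" "Y1 \<subseteq> words r" using Suc.prems by (auto simp: Y0_def Y1_def words_def)
  define S0 where "S0 = {m \<in> words r. shatters Y0 m}"
  define S1 where "S1 = {m \<in> words r. shatters Y1 m}"
  have fin: "finite S0" "finite S1" by (auto simp: S0_def S1_def)
  have "{m \<in> words (Suc r). shatters Y m} = (#) True ` (S0 \<inter> S1) \<union> (#) False ` (S0 \<union> S1)"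
    by (auto simp: words_Suc S0_def S1_def Y0_def Y1_def)
  moreover have "card \<dots> = card (S0 \<inter> S1) + card (S0 \<union> S1)"
    using fin by (subst card_Un_disjoint) (auto simp: card_image)
  moreover have "\<dots> = card S0 + card S1" using card_Un_Int[OF fin] by simp
  moreover have "\<dots> = card Y0 + card Y1" unfolding S0_def S1_def using Suc.IH sub by simp
  moreover have "card Y = card Y0 + card Y1"
  proof -
    have "Y = (#) False ` Y0 \<union> (#) True ` Y1"
    proof
      show "Y \<subseteq> (#) False ` Y0 \<union> (#) True ` Y1"
      proof
        fix y assume "y \<in> Y"
        with Suc.prems obtain b z where "y = b # z" by (auto simp: words_def length_Suc_conv)
        with \<open>y \<in> Y\<close> show "y \<in> (#) False ` Y0 \<union> (#) True ` Y1"
          by (cases b) (auto simp: Y0_def Y1_def)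
      qed
    qed (auto simp: Y0_def Y1_def)
    moreover have "card ((#) False ` Y0 \<union> (#) True ` Y1) = card Y0 + card Y1"
      using finite_subset[OF sub(1)] finite_subset[OF sub(2)]
      by (subst card_Un_disjoint) (auto simp: card_image)
    ultimately show ?thesis by simp
  qed
  ultimately show ?case by simp
qed

text \<open>The branching tree of the mask is the embedded cube. At a \<open>True\<close> the
  embeddings of the two subtrees may differ, but both have the level map \<open>true_pos m\<close>,
  so they can be glued; at a \<open>False\<close> one available letter is prepended.\<close>

lemma shatters_embeds:
  assumes "shatters Y m"
  shows "\<exists>\<phi>. embeds (length (filter (\<lambda>a. a) m)) (length m) (true_pos m) \<phi> \<and>
           \<phi> ` words (length (filter (\<lambda>a. a) m)) \<subseteq> Y"
  using assms
proof (induction m arbitrary: Y)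
  case Nil
  thus ?case by (intro exI[of _ id]) (auto simp: embeds_def meets_def)
next
  case (Cons b m)
  let ?n = "length (filter (\<lambda>a. a) m)"
  have mono: "\<forall>i j. i < j \<longrightarrow> j < N \<longrightarrow> true_pos m' i < true_pos m' j" for N m'
    by (simp add: true_pos_mono)
  show ?case
  proof (cases b)
    case True
    with Cons.prems have "shatters {y. False # y \<in> Y} m" "shatters {y. True # y \<in> Y} m" by auto
    then obtain \<phi>0 \<phi>1 where
      0: "embeds ?n (length m) (true_pos m) \<phi>0" "\<phi>0 ` words ?n \<subseteq> {y. False # y \<in> Y}" and
      1: "embeds ?n (length m) (true_pos m) \<phi>1" "\<phi>1 ` words ?n \<subseteq> {y. True # y \<in> Y}"
      using Cons.IH by meson
    define \<phi> where "\<phi> u = (if hd u then True # \<phi>1 (tl u) else False # \<phi>0 (tl u))" for u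
    have "embeds (Suc ?n) (Suc (length m)) (true_pos (True # m)) \<phi>"
      unfolding embeds_def
    proof (intro conjI ballI allI impI)
      fix u v i assume uv: "u \<in> words (Suc ?n)" "v \<in> words (Suc ?n)" "meets i u v"
      obtain a u' c v' where eq: "u = a # u'" "v = c # v'" "u' \<in> words ?n" "v' \<in> words ?n"
        using uv(1,2) by (auto simp: words_Suc)
      show "meets (true_pos (True # m) i) (\<phi> u) (\<phi> v)"
      proof (cases i)
        case 0
        thus ?thesis using uv(3) by (simp add: eq \<phi>_def)
      next
        case (Suc j)
        thus ?thesis using uv(3) eq embeds_meets[OF 0(1), of u' v' j] embeds_meets[OF 1(1), of u' v' j]
          by (cases a) (auto simp: \<phi>_def meets_Suc_Cons)
      qed
    qed (use 0(1) 1(1) mono[of _ "True # m"] in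
        \<open>auto simp: \<phi>_def words_Suc embeds_def image_subset_iff\<close>)
    moreover have "\<phi> ` words (Suc ?n) \<subseteq> Y"
      using 0(2) 1(2) by (auto simp: \<phi>_def words_Suc)
    ultimately show ?thesis using True by auto
  next
    case False
    with Cons.prems obtain c where "shatters {y. c # y \<in> Y} m" by auto
    then obtain \<phi> where
      \<phi>: "embeds ?n (length m) (true_pos m) \<phi>" "\<phi> ` words ?n \<subseteq> {y. c # y \<in> Y}"
      using Cons.IH by meson
    have "embeds ?n (Suc (length m)) (true_pos (False # m)) (\<lambda>u. c # \<phi> u)"
      using \<phi>(1) mono[of _ "False # m"] unfolding embeds_def
      by (auto simp: words_def)
    moreover have "(\<lambda>u. c # \<phi> u) ` words ?n \<subseteq> Y" using \<phi>(2) by auto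
    ultimately show ?thesis using False by (auto simp del: true_pos.simps)
  qed
qed

section \<open>Masks with few branchings, and cubes inside large sets\<close>

lemma sum_words_false_pow: "(\<Sum>m\<in>words r. 2 ^ length (filter Not m)) = (3::nat) ^ r"
proof (induction r)
  case (Suc r)
  have "(\<Sum>m\<in>words (Suc r). 2 ^ length (filter Not m)) =
      (\<Sum>m\<in>words r. 2 ^ length (filter Not m)) + (\<Sum>m\<in>words r. 2 * (2::nat) ^ length (filter Not m))"
    unfolding words_Suc
    by (subst sum.union_disjoint) (auto simp: sum.reindex)
  thus ?case using Suc by (simp add: sum_distrib_left[symmetric])
qed auto

text \<open>Exponential weights: a mask with fewer than \<open>h\<close> marks has at least
  \<open>r - h\<close> unmarked letters, hence weight at least \<open>2 ^ r / 2 ^ h\<close>, while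
  the total weight is \<open>3 ^ r\<close>.\<close>

lemma card_few_true: "card {m \<in> words r. length (filter (\<lambda>a. a) m) < h} * 2 ^ r \<le> 3 ^ r * 2 ^ h"
proof -
  let ?S = "{m \<in> words r. length (filter (\<lambda>a. a) m) < h}"
  have "card ?S * 2 ^ r = (\<Sum>m\<in>?S. 2 ^ r)" by simp
  also have "\<dots> \<le> (\<Sum>m\<in>?S. 2 ^ length (filter Not m) * 2 ^ h)"
  proof (rule sum_mono)
    fix m assume m: "m \<in> ?S"
    have "length (filter (\<lambda>a. a) m) + length (filter Not m) = length m"
      using sum_length_filter_compl[of "\<lambda>a. a" m] by (simp add: comp_def)
    with m have "r \<le> length (filter Not m) + h" by (auto simp: words_def)
    hence "(2::nat) ^ r \<le> 2 ^ (length (filter Not m) + h)" by (intro power_increasing) auto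
    thus "(2::nat) ^ r \<le> 2 ^ length (filter Not m) * 2 ^ h" by (simp add: power_add)
  qed
  also have "\<dots> \<le> (\<Sum>m\<in>words r. 2 ^ length (filter Not m) * 2 ^ h)"
    by (rule sum_mono2) auto
  also have "\<dots> = 3 ^ r * 2 ^ h" by (simp add: sum_distrib_right[symmetric] sum_words_false_pow)
  finally show ?thesis .
qed

text \<open>\<open>Y\<close> shatters as many masks as it has elements, more than there are masks
  with fewer than \<open>h\<close> marks. So it shatters one with at least \<open>h\<close>, and the
  resulting cube is cut down to dimension \<open>h\<close>.\<close>

lemma large_set_embeds_cube:
  assumes Y: "Y \<subseteq> words r" and big: "3 ^ r * 2 ^ h < card Y * 2 ^ r"
  obtains g \<phi> where "embeds h r g \<phi>" "\<phi> ` words h \<subseteq> Y"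
proof -
  have "\<exists>m\<in>words r. shatters Y m \<and> h \<le> length (filter (\<lambda>a. a) m)"
  proof (rule ccontr)
    assume "\<not> ?thesis"
    hence "{m \<in> words r. shatters Y m} \<subseteq> {m \<in> words r. length (filter (\<lambda>a. a) m) < h}" by auto
    hence "card Y \<le> card {m \<in> words r. length (filter (\<lambda>a. a) m) < h}"
      unfolding card_shattered[OF Y, symmetric] by (intro card_mono) auto
    hence "card Y * 2 ^ r \<le> card {m \<in> words r. length (filter (\<lambda>a. a) m) < h} * 2 ^ r"
      by (rule mult_right_mono) simp
    with card_few_true[of r h] big show False by linarith
  qed
  then obtain m where m: "m \<in> words r" "shatters Y m" "h \<le> length (filter (\<lambda>a. a) m)" by blast
  let ?n = "length (filter (\<lambda>a. a) m)"
  obtain \<phi> where "embeds ?n r (true_pos m) \<phi>" "\<phi> ` words ?n \<subseteq> Y"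
    using shatters_embeds[OF m(2)] m(1) by (auto simp: words_def)
  with embeds_pad[OF _ m(3)] m(3) show ?thesis
    by (intro that[of "true_pos m" "\<lambda>u. \<phi> (u @ replicate (?n - h) False)"])
       (auto simp: words_def image_subset_iff)
qed


subsection \<open>One colour\<close>

definition fiber :: "bool list set \<Rightarrow> bool list \<Rightarrow> bool list set" where
  "fiber A y = {u. y @ u \<in> A}"

lemma fiber_subset_words: "A \<subseteq> words (r + L) \<Longrightarrow> y \<in> words r \<Longrightarrow> fiber A y \<subseteq> words L"
  by (auto simp: fiber_def words_def)

lemma card_eq_sum_fibers:
  assumes "A \<subseteq> words (r + L)"
  shows "card A = (\<Sum>y\<in>words r. card (fiber A y))"
proof -
  have fin: "finite (fiber A y)" if "y \<in> words r" for y
    using fiber_subset_words[OF assms that] by (rule finite_subset) simp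
  have "(\<lambda>(y, u). y @ u) ` (SIGMA y:words r. fiber A y) = A"
  proof
    show "A \<subseteq> (\<lambda>(y, u). y @ u) ` (SIGMA y:words r. fiber A y)"
    proof
      fix w assume "w \<in> A"
      with assms have "take r w \<in> words r" "drop r w \<in> fiber A (take r w)"
        by (auto simp: words_def fiber_def)
      thus "w \<in> (\<lambda>(y, u). y @ u) ` (SIGMA y:words r. fiber A y)"
        by (intro image_eqI[of _ _ "(take r w, drop r w)"]) auto
    qed
  qed (auto simp: fiber_def)
  moreover have "inj_on (\<lambda>(y, u). y @ u) (SIGMA y:words r. fiber A y)"
    by (auto simp: inj_on_def words_def)
  ultimately have "card A = card (SIGMA y:words r. fiber A y)" by (metis card_image)
  thus ?thesis using fin by simp
qed

lemma dense_fiber_exists: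
  assumes "A \<subseteq> words (r + L)" "2 ^ (r + L) \<le> card A * d"
  obtains y where "y \<in> words r" "2 ^ L \<le> card (fiber A y) * d"
proof -
  have "\<exists>y\<in>words r. 2 ^ L \<le> card (fiber A y) * d"
  proof (rule ccontr)
    assume "\<not> ?thesis"
    hence "(\<Sum>y\<in>words r. card (fiber A y) * d) < (\<Sum>y\<in>words r. 2 ^ L)"
      by (intro sum_strict_mono) auto
    with assms(2) show False
      by (simp add: card_eq_sum_fibers[OF assms(1)] sum_distrib_right power_add)
  qed
  thus ?thesis using that by blast
qed

text \<open>Fibres of density below \<open>1 / 2 ^ Suc D\<close> hold at most half of the guaranteed
  mass of \<open>A\<close>; the other half needs many prefixes, since a fibre has at most
  \<open>2 ^ L\<close> words.\<close>

lemma many_dense_fibers: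
  assumes "A \<subseteq> words (r + L)" "2 ^ (r + L) \<le> card A * 2 ^ D"
  shows "2 ^ r \<le> card {y \<in> words r. 2 ^ L \<le> card (fiber A y) * 2 ^ Suc D} * 2 ^ Suc D"
proof -
  define Y where "Y = {y \<in> words r. 2 ^ L \<le> card (fiber A y) * 2 ^ Suc D}"
  have Y: "Y \<subseteq> words r" by (auto simp: Y_def)
  have "card A * 2 ^ Suc D = (\<Sum>y\<in>words r. card (fiber A y) * 2 ^ Suc D)"
    by (simp only: card_eq_sum_fibers[OF assms(1)] sum_distrib_right)
  also have "\<dots> = (\<Sum>y\<in>words r - Y. card (fiber A y) * 2 ^ Suc D) + (\<Sum>y\<in>Y. card (fiber A y) * 2 ^ Suc D)"
    using Y by (intro sum.subset_diff) auto
  also have "(\<Sum>y\<in>words r - Y. card (fiber A y) * 2 ^ Suc D) \<le> (\<Sum>y\<in>words r - Y. 2 ^ L)"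
    by (intro sum_mono) (auto simp: Y_def)
  also have "\<dots> \<le> (\<Sum>y\<in>words r. 2 ^ L)" by (intro sum_mono2) auto
  also have "\<dots> = 2 ^ (r + L)" by (simp add: power_add)
  also have "(\<Sum>y\<in>Y. card (fiber A y) * 2 ^ Suc D) \<le> (\<Sum>y\<in>Y. 2 ^ L * 2 ^ Suc D)"
  proof (intro sum_mono mult_right_mono)
    fix y assume "y \<in> Y"
    hence "fiber A y \<subseteq> words L" using fiber_subset_words[OF assms(1)] Y by auto
    thus "card (fiber A y) \<le> 2 ^ L" using card_mono[of "words L"] by simp
  qed auto
  finally have "card A * 2 ^ Suc D \<le> 2 ^ (r + L) + card Y * 2 ^ Suc D * 2 ^ L" by (simp add: mult_ac)
  moreover have "2 * 2 ^ (r + L) \<le> card A * 2 ^ Suc D" using assms(2) by simp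
  ultimately have "2 ^ (r + L) \<le> card Y * 2 ^ Suc D * 2 ^ L" by linarith
  hence "2 ^ L * 2 ^ r \<le> 2 ^ L * (card Y * 2 ^ Suc D)" by (simp only: power_add mult_ac)
  thus ?thesis by (simp add: Y_def)
qed

text \<open>The prefixes with dense fibres are numerous enough to contain a cube of dimension
  \<open>h\<close>. If every pair of its fibres were sparse in \<open>R\<close>, one word could be
  picked from each fibre so that the result is a free cube.\<close>

lemma dense_pair:
  assumes A: "A \<subseteq> words (r + L)" and dense: "2 ^ (r + L) \<le> card A * 2 ^ D"
    and r: "r = 5 * \<rho>" and \<rho>: "D + h + 1 < 2 * \<rho>" and nofree: "\<not> free_cube h (r + L) R"
  obtains l y z where "y \<in> words r" "z \<in> words r" "meets l y z"
    "2 ^ L \<le> card (fiber A y) * 2 ^ Suc D" "2 ^ L \<le> card (fiber A z) * 2 ^ Suc D"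
    "card (fiber A y) * card (fiber A z) \<le>
       card {p \<in> fiber A y \<times> fiber A z. R (y @ fst p) (z @ snd p)} * 2 ^ (2 * h)"
proof -
  define Y where "Y = {y \<in> words r. 2 ^ L \<le> card (fiber A y) * 2 ^ Suc D}"
  have Y: "Y \<subseteq> words r" by (auto simp: Y_def)
  have cY: "2 ^ r \<le> card Y * 2 ^ Suc D"
    using many_dense_fibers[OF A dense] by (simp add: Y_def)
  \<comment> \<open>The factor 5 in \<open>r = 5 * \<rho>\<close> enters through
    \<open>3 ^ 5 = 243 \<le> 256 = 2 ^ 8\<close>.\<close>
  have "(3::nat) ^ r * 2 ^ h * 2 ^ Suc D \<le> 2 ^ (8 * \<rho>) * 2 ^ h * 2 ^ Suc D"
    unfolding r power_mult by (intro mult_right_mono power_mono) auto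
  also have "\<dots> = 2 ^ (8 * \<rho> + h + Suc D)" by (simp add: power_add)
  also have "\<dots> < 2 ^ (r + r)" using r \<rho> by (intro power_strict_increasing) auto
  also have "\<dots> = 2 ^ r * 2 ^ r" by (simp add: power_add)
  also have "\<dots> \<le> card Y * 2 ^ Suc D * 2 ^ r" using cY by (rule mult_right_mono) simp
  finally have "2 ^ Suc D * (3 ^ r * 2 ^ h) < 2 ^ Suc D * (card Y * 2 ^ r)" by (simp only: mult_ac)
  hence "3 ^ r * 2 ^ h < card Y * 2 ^ r" by simp
  from large_set_embeds_cube[OF Y this]
  obtain g \<phi> where \<phi>: "embeds h r g \<phi>" "\<phi> ` words h \<subseteq> Y" by blast
  have "\<exists>l. \<exists>y\<in>Y. \<exists>z\<in>Y. meets l y z \<and> card (fiber A y) * card (fiber A z) \<le>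
       card {p \<in> fiber A y \<times> fiber A z. R (y @ fst p) (z @ snd p)} * 2 ^ (2 * h)"
  proof (rule ccontr)
    assume "\<not> ?thesis"
    hence sparse: "card {p \<in> fiber A y \<times> fiber A z. R (y @ fst p) (z @ snd p)} * 2 ^ (2 * h)
       \<le> card (fiber A y) * card (fiber A z)" if "y \<in> Y" "z \<in> Y" "meets l y z" for l y z
      using that by (meson nat_le_linear)
    \<comment> \<open>The transversal is avoided over all ordered pairs, but only pairs in the order
      of their first difference matter; the reversed pairs are never bad.\<close>
    define B where "B u v x x' \<longleftrightarrow> (\<exists>i. meets i u v) \<and> R (\<phi> u @ x) (\<phi> v @ x')" for u v x x'
    have "\<exists>f. (\<forall>u\<in>words h. f u \<in> fiber A (\<phi> u)) \<and>
        (\<forall>u\<in>words h. \<forall>v\<in>words h. u \<noteq> v \<longrightarrow> \<not> B u v (f u) (f v))"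
    proof (rule transversal_avoiding)
      fix u assume "u \<in> words h"
      hence u: "\<phi> u \<in> Y" using \<phi>(2) by auto
      thus "finite (fiber A (\<phi> u))"
        using fiber_subset_words[OF A] Y by (meson finite_subset finite_words subsetD)
      have "card (fiber A (\<phi> u)) \<noteq> 0" using u by (auto simp: Y_def intro!: Nat.gr0I)
      thus "fiber A (\<phi> u) \<noteq> {}" by auto
      fix v assume "v \<in> words h"
      hence v: "\<phi> v \<in> Y" using \<phi>(2) by auto
      show "card {p \<in> fiber A (\<phi> u) \<times> fiber A (\<phi> v). B u v (fst p) (snd p)} * (card (words h))\<^sup>2
          \<le> card (fiber A (\<phi> u)) * card (fiber A (\<phi> v))"
      proof (cases "\<exists>i. meets i u v")
        case True
        then obtain i where "meets i u v" by blast
        hence "meets (g i) (\<phi> u) (\<phi> v)"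
          using embeds_meets[OF \<phi>(1) \<open>u \<in> words h\<close> \<open>v \<in> words h\<close>] by simp
        from sparse[OF u v this] show ?thesis
          using True by (simp add: B_def power_mult mult.commute[of 2])
      qed (simp add: B_def)
    qed simp
    then obtain f where f: "\<And>u. u \<in> words h \<Longrightarrow> f u \<in> fiber A (\<phi> u)"
      "\<And>u v. u \<in> words h \<Longrightarrow> v \<in> words h \<Longrightarrow> u \<noteq> v \<Longrightarrow> \<not> B u v (f u) (f v)" by blast
    have "embeds h (r + L) g (\<lambda>u. \<phi> u @ f u)"
      unfolding embeds_def
    proof (intro conjI ballI allI impI)
      show "(\<lambda>u. \<phi> u @ f u) ` words h \<subseteq> words (r + L)"
        using f(1) A by (auto simp: fiber_def)
      show "meets (g i) (\<phi> u @ f u) (\<phi> v @ f v)"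
        if "u \<in> words h" "v \<in> words h" "meets i u v" for u v i
        using embeds_meets[OF \<phi>(1) that] by (rule meets_append)
    qed (use \<phi>(1) in \<open>auto simp: embeds_def\<close>)
    moreover have "\<not> R (\<phi> u @ f u) (\<phi> v @ f v)"
      if "u \<in> words h" "v \<in> words h" "meets i u v" for u v i
      using f(2)[OF that(1,2) meets_neq[OF that(3)]] that(3) by (auto simp: B_def)
    ultimately have "free_cube h (r + L) R" unfolding free_cube_def by blast
    with nofree show False by contradiction
  qed
  thus ?thesis using that by (auto simp: Y_def)
qed

text \<open>Positions of the current words are counted from the start of block \<open>\<beta>\<close>; the gap with index \<open>s\<close>
  has to be realised in block \<open>b s\<close>.\<close>
definition clique_pattern ::
  "(nat \<Rightarrow> nat) \<Rightarrow> nat \<Rightarrow> nat \<Rightarrow> (bool list \<Rightarrow> bool list \<Rightarrow> bool) \<Rightarrow> bool list set \<Rightarrow>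
     nat \<Rightarrow> nat \<Rightarrow> (nat \<Rightarrow> bool list) \<Rightarrow> bool" where
  "clique_pattern b r \<beta> R A i j a \<longleftrightarrow> a ` {i..j} \<subseteq> A \<and>
     (\<forall>s\<in>{i..<j}. \<exists>l. meets l (a s) (a (Suc s)) \<and> b s * r \<le> \<beta> * r + l \<and> \<beta> * r + l < Suc (b s) * r) \<and>
     (\<forall>s t. i \<le> s \<longrightarrow> s < t \<longrightarrow> t \<le> j \<longrightarrow> R (a s) (a t))"

lemma clique_pattern_append:
  assumes "clique_pattern b r (Suc \<beta>) (\<lambda>u v. R (y @ u) (y @ v)) B i j a"
    and "B \<subseteq> fiber A y" and y: "y \<in> words r"
  shows "clique_pattern b r \<beta> R A i j (\<lambda>s. y @ a s)"
  unfolding clique_pattern_def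
proof (intro conjI ballI)
  fix s assume "s \<in> {i..<j}"
  with assms(1) obtain l where "meets l (a s) (a (Suc s))" "b s * r \<le> Suc \<beta> * r + l"
    "Suc \<beta> * r + l < Suc (b s) * r" unfolding clique_pattern_def by blast
  with y show "\<exists>l. meets l (y @ a s) (y @ a (Suc s)) \<and> b s * r \<le> \<beta> * r + l \<and> \<beta> * r + l < Suc (b s) * r"
    by (intro exI[of _ "r + l"]) (auto simp: words_def intro: meets_append_same)
qed (use assms in \<open>auto simp: clique_pattern_def fiber_def image_subset_iff\<close>)

text \<open>Every block costs at most \<open>E\<close> bits of density: \<open>2 h t + 2\<close> on the left of a gap, where dependent
  random choice is used, and \<open>s + 1\<close> on the right.\<close>
lemma clique_pattern_exists:
  assumes r: "r = 5 * \<rho>" and \<rho>: "E * m + h + 1 < 2 * \<rho>"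
    and E: "2 * h * t + 2 \<le> E" "s + 1 \<le> E" and st: "k * (m * r) + 2 * h * t + 1 < s * t"
  assumes "n + \<beta> = m" "A \<subseteq> words (n * r)" "2 ^ (n * r) \<le> card A * 2 ^ (E * \<beta>)"
    and "i \<le> j" "j < i + k" "inj_on b {i..<j}" "\<And>x. x \<in> {i..<j} \<Longrightarrow> \<beta> \<le> b x \<and> b x < m"
    and "\<not> free_cube h (n * r) R"
  shows "\<exists>a. clique_pattern b r \<beta> R A i j a"
  using assms(6-)
proof (induction n arbitrary: \<beta> A R i j)
  \<comment> \<open>No block is left, so no gap is left to realise: the clique is a single
    word.\<close>
  case 0
  have "i = j"
  proof (rule ccontr)
    assume "i \<noteq> j"
    hence "i \<in> {i..<j}" using "0.prems" by simp
    from "0.prems"(7)[OF this] "0.prems"(1) show False by simp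
  qed
  moreover have "A \<noteq> {}" using "0.prems" by auto
  ultimately show ?case by (auto simp: clique_pattern_def)
next
  case (Suc n)
  have A: "A \<subseteq> words (r + n * r)" and cA: "2 ^ (r + n * r) \<le> card A * 2 ^ (E * \<beta>)"
    using Suc.prems(2,3) by auto
  have nofree: "\<not> free_cube h (n * r) (\<lambda>u v. R (y @ u) (y @ v))" if "y \<in> words r" for y
    using free_cube_append[of h "n * r" R y] that Suc.prems(8) by (auto simp: words_def)
  show ?case
  proof (cases "\<beta> \<in> b ` {i..<j}")
    case False
    \<comment> \<open>No gap belongs to this block; it is skipped by fixing a prefix of at least
      average density, at no cost.\<close>
    obtain y where y: "y \<in> words r" "2 ^ (n * r) \<le> card (fiber A y) * 2 ^ (E * \<beta>)"
      using dense_fiber_exists[OF A cA] by blast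
    have "\<exists>a. clique_pattern b r (Suc \<beta>) (\<lambda>u v. R (y @ u) (y @ v)) (fiber A y) i j a"
    proof (rule Suc.IH)
      show "2 ^ (n * r) \<le> card (fiber A y) * 2 ^ (E * Suc \<beta>)"
        by (rule order_trans[OF y(2)]) (intro mult_left_mono power_increasing, auto)
      show "\<And>x. x \<in> {i..<j} \<Longrightarrow> Suc \<beta> \<le> b x \<and> b x < m"
        using Suc.prems(7) False by (metis Suc_leI image_eqI order_le_imp_less_or_eq)
    qed (use Suc.prems nofree y(1) fiber_subset_words[OF A] in auto)
    thus ?thesis using clique_pattern_append[OF _ order_refl y(1)] by blast
  next
    case True
    \<comment> \<open>The gap after \<open>x0\<close> is the one realised here. It splits the clique
      into indices \<open>i..x0\<close>, sought over the prefix \<open>y\<close>, and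
      \<open>Suc x0..j\<close>, sought over \<open>z\<close>.\<close>
    then obtain x0 where x0: "x0 \<in> {i..<j}" "b x0 = \<beta>" by auto
    have other: "Suc \<beta> \<le> b x \<and> b x < m" if "x \<in> {i..<j}" "x \<noteq> x0" for x
      using Suc.prems(7)[OF that(1)] inj_onD[OF Suc.prems(6), of x x0] x0 that by fastforce
    have "E * \<beta> \<le> E * m" using Suc.prems(1) by (intro mult_left_mono) auto
    hence "E * \<beta> + h + 1 < 2 * \<rho>" using \<rho> by linarith
    moreover have "\<not> free_cube h (r + n * r) R" using Suc.prems(8) by simp
    ultimately obtain l y z where y: "y \<in> words r" and z: "z \<in> words r" and l: "meets l y z"
      and cy: "2 ^ (n * r) \<le> card (fiber A y) * 2 ^ Suc (E * \<beta>)"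
      and cz: "2 ^ (n * r) \<le> card (fiber A z) * 2 ^ Suc (E * \<beta>)"
      and yz: "card (fiber A y) * card (fiber A z) \<le>
       card {p \<in> fiber A y \<times> fiber A z. R (y @ fst p) (z @ snd p)} * 2 ^ (2 * h)"
      using dense_pair[OF A cA r] by blast
    note sub = fiber_subset_words[OF A y] fiber_subset_words[OF A z]
    \<comment> \<open>The number of vertices to the left of the gap, hence the size of the tuples
      that need common neighbours.\<close>
    define m' where "m' = Suc x0 - i"
    have "card (fiber A y) \<le> 2 ^ (m * r)"
    proof -
      have "card (fiber A y) \<le> 2 ^ (n * r)" using card_mono[OF _ sub(1)] by simp
      also have "\<dots> \<le> 2 ^ (m * r)" using Suc.prems(1) by (intro power_increasing mult_right_mono) auto
      finally show ?thesis .
    qed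
    hence "card (fiber A y) ^ m' * 2 ^ (2 * h * t + 1) \<le> (2 ^ (m * r)) ^ m' * 2 ^ (2 * h * t + 1)"
      by (intro mult_right_mono power_mono) auto
    also have "\<dots> = 2 ^ (m' * (m * r) + 2 * h * t + 1)"
      by (simp add: power_add power_mult[symmetric] mult_ac)
    also have "\<dots> < 2 ^ (s * t)"
    proof (rule power_strict_increasing)
      have "m' * (m * r) \<le> k * (m * r)" using x0 Suc.prems(5) by (intro mult_right_mono) (auto simp: m'_def)
      thus "m' * (m * r) + 2 * h * t + 1 < s * t" using st by linarith
    qed simp
    finally have big: "card (fiber A y) ^ m' * 2 ^ (2 * h * t + 1) < 2 ^ (s * t)" .
    have ne: "fiber A y \<noteq> {}" "fiber A z \<noteq> {}" using cy cz by auto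
    obtain U where U: "U \<subseteq> fiber A y" "card (fiber A y) \<le> card U * 2 ^ (2 * h * t + 1)"
      "\<And>xs. length xs = m' \<Longrightarrow> set xs \<subseteq> U \<Longrightarrow> card (fiber A z) \<le>
         card {v \<in> fiber A z. \<forall>u\<in>set xs. R (y @ u) (z @ v)} * 2 ^ s"
      using dependent_random_choice[OF finite_subset[OF sub(1)] finite_subset[OF sub(2)] ne yz big] by auto
    have "\<exists>a. clique_pattern b r (Suc \<beta>) (\<lambda>u v. R (y @ u) (y @ v)) U i x0 a"
    proof (rule Suc.IH)
      \<comment> \<open>One bit is lost in passing to a dense fibre and \<open>2 * h * t + 1\<close>
        bits in dependent random choice.\<close>
      have "2 ^ (n * r) \<le> card U * 2 ^ (2 * h * t + 1) * 2 ^ Suc (E * \<beta>)"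
        using order_trans[OF cy mult_right_mono[OF U(2)]] by simp
      also have "\<dots> = card U * 2 ^ (2 * h * t + 2 + E * \<beta>)" by (simp add: power_add)
      also have "\<dots> \<le> card U * 2 ^ (E * Suc \<beta>)"
        using E by (intro mult_left_mono power_increasing) auto
      finally show "2 ^ (n * r) \<le> card U * 2 ^ (E * Suc \<beta>)" .
      show "inj_on b {i..<x0}" using Suc.prems(6) x0 by (auto intro: inj_on_subset)
      show "\<not> free_cube h (n * r) (\<lambda>u v. R (y @ u) (y @ v))" using nofree[OF y] .
    qed (use Suc.prems(1,4,5) x0 U(1) sub other in auto)
    then obtain a1 where a1: "clique_pattern b r (Suc \<beta>) (\<lambda>u v. R (y @ u) (y @ v)) U i x0 a1" by blast
    define xs where "xs = map a1 [i..<Suc x0]"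
    have set_xs: "set xs = a1 ` {i..x0}" unfolding xs_def by (simp add: atLeastLessThanSuc_atLeastAtMost del: upt_Suc)
    \<comment> \<open>Restricting the right part to common neighbours of the whole left part makes
      every cross pair satisfy \<open>R\<close>, whatever the recursion finds inside
      \<open>Z\<close>.\<close>
    define Z where "Z = {v \<in> fiber A z. \<forall>u\<in>set xs. R (y @ u) (z @ v)}"
    have cZ: "card (fiber A z) \<le> card Z * 2 ^ s"
      unfolding Z_def using a1 set_xs by (intro U(3)) (auto simp: xs_def m'_def clique_pattern_def)
    have "\<exists>a. clique_pattern b r (Suc \<beta>) (\<lambda>u v. R (z @ u) (z @ v)) Z (Suc x0) j a"
    proof (rule Suc.IH)
      have "2 ^ (n * r) \<le> card Z * 2 ^ s * 2 ^ Suc (E * \<beta>)"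
        using order_trans[OF cz mult_right_mono[OF cZ]] by simp
      also have "\<dots> = card Z * 2 ^ (s + 1 + E * \<beta>)" by (simp add: power_add)
      also have "\<dots> \<le> card Z * 2 ^ (E * Suc \<beta>)"
        using E by (intro mult_left_mono power_increasing) auto
      finally show "2 ^ (n * r) \<le> card Z * 2 ^ (E * Suc \<beta>)" .
      show "inj_on b {Suc x0..<j}" using Suc.prems(6) x0 by (auto intro: inj_on_subset)
      show "\<not> free_cube h (n * r) (\<lambda>u v. R (z @ u) (z @ v))" using nofree[OF z] .
    qed (use Suc.prems(1,4,5) x0 sub other in \<open>auto simp: Z_def\<close>)
    then obtain a2 where a2: "clique_pattern b r (Suc \<beta>) (\<lambda>u v. R (z @ u) (z @ v)) Z (Suc x0) j a2" by blast
    have p1: "clique_pattern b r \<beta> R A i x0 (\<lambda>x. y @ a1 x)"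
      using clique_pattern_append[OF a1 U(1) y] .
    have p2: "clique_pattern b r \<beta> R A (Suc x0) j (\<lambda>x. z @ a2 x)"
      using clique_pattern_append[OF a2 _ z] by (auto simp: Z_def)
    define a where "a x = (if x \<le> x0 then y @ a1 x else z @ a2 x)" for x
    have "clique_pattern b r \<beta> R A i j a"
      unfolding clique_pattern_def
    proof (intro conjI ballI allI impI)
      show "a ` {i..j} \<subseteq> A"
        using p1 p2 by (auto simp: a_def clique_pattern_def image_subset_iff)
    next
      fix x assume x: "x \<in> {i..<j}"
      consider "x < x0" | "x = x0" | "x > x0" by linarith
      thus "\<exists>l. meets l (a x) (a (Suc x)) \<and> b x * r \<le> \<beta> * r + l \<and> \<beta> * r + l < Suc (b x) * r"
      proof cases
        case 1
        thus ?thesis using p1 x by (auto simp: a_def clique_pattern_def)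
      next
        case 2
        \<comment> \<open>At the split, the first difference is that of the prefixes, so it lies
          inside the current block.\<close>
        have "l < r" using l y by (auto simp: meets_def words_def)
        thus ?thesis using 2 x0 l by (auto simp: a_def intro!: exI[of _ l] meets_append)
      next
        case 3
        thus ?thesis using p2 x by (auto simp: a_def clique_pattern_def)
      qed
    next
      fix x x' assume x: "i \<le> x" "x < x'" "x' \<le> j"
      consider "x' \<le> x0" | "x \<le> x0" "x0 < x'" | "x0 < x" by linarith
      thus "R (a x) (a x')"
      proof cases
        case 1
        thus ?thesis using p1 x by (auto simp: a_def clique_pattern_def)
      next
        case 2
        hence "a2 x' \<in> Z" using a2 x by (auto simp: clique_pattern_def)
        thus ?thesis using 2 x by (auto simp: a_def Z_def set_xs)
      next
        case 3
        thus ?thesis using p2 x by (auto simp: a_def clique_pattern_def)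
      qed
    qed
    thus ?thesis by blast
  qed
qed


subsection \<open>All colours\<close>

text \<open>\<open>b\<close> ranks the gaps, the smallest rank standing for the largest gap. Only
  the relative order of levels is recorded, as blocks are not preserved by embeddings.\<close>

definition cube_clique ::
  "(nat \<Rightarrow> nat) \<Rightarrow> nat \<Rightarrow> nat \<Rightarrow> (bool list \<Rightarrow> bool list \<Rightarrow> bool) \<Rightarrow> (nat \<Rightarrow> bool list) \<Rightarrow> (nat \<Rightarrow> nat) \<Rightarrow> bool" where
  "cube_clique b k M R a lev \<longleftrightarrow> a ` {1..k} \<subseteq> words M \<and>
     (\<forall>x\<in>{1..<k}. meets (lev x) (a x) (a (Suc x))) \<and>
     (\<forall>x\<in>{1..<k}. \<forall>y\<in>{1..<k}. b x < b y \<longrightarrow> lev x < lev y) \<and>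
     (\<forall>s t. 1 \<le> s \<longrightarrow> s < t \<longrightarrow> t \<le> k \<longrightarrow> R (a s) (a t))"

text \<open>A choice of parameters. With \<open>t = X - 1\<close> and \<open>s = 2 * h * t\<close>
  the losses on the two sides of a gap nearly agree, and \<open>E = 2 * h * X\<close> covers both.
  The block length \<open>r = 10 * h * X * k\<close> gives \<open>(k - 1) * r\<close> positions in
  total.\<close>

lemma clique_or_free_cube:
  assumes k: "k \<ge> 2" and h: "h \<ge> 1" and inj: "inj_on b {1..<k}" and b: "\<And>x. x \<in> {1..<k} \<Longrightarrow> b x < k - 1"
    and nofree: "\<not> free_cube h (50 * k ^ 4 * (k - 1) * h) R"
  shows "\<exists>a lev. cube_clique b k (50 * k ^ 4 * (k - 1) * h) R a lev"
proof -
  define M where "M = 50 * k ^ 4 * (k - 1) * h"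
  define X where "X = 5 * k ^ 3"
  define \<rho> where "\<rho> = 2 * h * X * k"
  define r where "r = 5 * \<rho>"
  obtain k' where k': "k = Suc k'" using k by (cases k) auto
  have X: "1 \<le> X" using k by (simp add: X_def)
  then obtain X' where X': "X = Suc X'" by (cases X) auto
  have M: "(k - 1) * r = M" by (simp add: M_def r_def \<rho>_def X_def power_numeral_reduce mult_ac)
  have "\<exists>a. clique_pattern b r 0 R (words M) 1 k a"
  proof (rule clique_pattern_exists[where E = "2 * h * X" and m = "k - 1" and h = h and t = "X - 1"
        and s = "2 * h * (X - 1)" and k = k and n = "k - 1"])
    show "r = 5 * \<rho>" by (fact r_def)
    have "h * 1 \<le> h * X" using X by (rule mult_left_mono) simp
    moreover have "2 * \<rho> = 2 * h * X * (k - 1) + 2 * h * X * (k - 1) + 4 * (h * X)"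
      by (simp add: \<rho>_def k' algebra_simps)
    ultimately show "2 * h * X * (k - 1) + h + 1 < 2 * \<rho>" using h by linarith
    show "2 * h * (X - 1) + 2 \<le> 2 * h * X" "2 * h * (X - 1) + 1 \<le> 2 * h * X"
      using h by (auto simp: X')
    show "k * ((k - 1) * r) + 2 * h * (X - 1) + 1 < 2 * h * (X - 1) * (X - 1)"
    \<comment> \<open>The value \<open>X = 5 * k ^ 3\<close> makes \<open>2 * X\<^sup>2\<close>
      equal to \<open>10 * k ^ 3 * X\<close>, which exceeds the main term by
      \<open>10 * k\<^sup>2 * X\<close>; this slack pays for the lower order terms.\<close>
    proof -
      have "10 * k\<^sup>2 * (k - 1) * X + 10 * k\<^sup>2 * X = 2 * X * X"
        by (simp add: X_def k' power_numeral_reduce algebra_simps)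
      moreover have "10 * 1 * X \<le> 10 * k\<^sup>2 * X" using k by (intro mult_right_mono mult_left_mono) auto
      moreover have "2 * X * X + 2 = 2 * (X - 1) * (X - 1) + 4 * X" by (simp add: X')
      ultimately have "10 * k\<^sup>2 * (k - 1) * X + 2 * (X - 1) + 1 < 2 * (X - 1) * (X - 1)"
        using X by linarith
      hence "h * (10 * k\<^sup>2 * (k - 1) * X + 2 * (X - 1) + 1) < h * (2 * (X - 1) * (X - 1))"
        using h by (intro mult_strict_left_mono) auto
      moreover have "k * ((k - 1) * r) + 2 * h * (X - 1) + 1 \<le> h * (10 * k\<^sup>2 * (k - 1) * X + 2 * (X - 1) + 1)"
        using h by (simp add: r_def \<rho>_def power2_eq_square algebra_simps)
      ultimately show ?thesis by (simp add: mult_ac)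
    qed
    show "words M \<subseteq> words ((k - 1) * r)" using M by simp
    show "2 ^ ((k - 1) * r) \<le> card (words M) * 2 ^ (2 * h * X * 0)" using M by simp
    show "\<not> free_cube h ((k - 1) * r) R" using nofree unfolding M M_def .
  qed (use k inj b in auto)
  then obtain a where a: "clique_pattern b r 0 R (words M) 1 k a" by blast
  hence "\<forall>x\<in>{1..<k}. \<exists>l. meets l (a x) (a (Suc x)) \<and> b x * r \<le> l \<and> l < Suc (b x) * r"
    by (auto simp: clique_pattern_def)
  then obtain lev where lev: "\<And>x. x \<in> {1..<k} \<Longrightarrow>
     meets (lev x) (a x) (a (Suc x)) \<and> b x * r \<le> lev x \<and> lev x < Suc (b x) * r" by metis
  have "lev x < lev y" if "x \<in> {1..<k}" "y \<in> {1..<k}" "b x < b y" for x y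
  proof -
    have "Suc (b x) * r \<le> b y * r" using that(3) by (intro mult_right_mono) auto
    thus ?thesis using lev[OF that(1)] lev[OF that(2)] by linarith
  qed
  with a lev have "cube_clique b k M R a lev" by (auto simp: cube_clique_def clique_pattern_def)
  thus ?thesis unfolding M_def by blast
qed

text \<open>The levels of the clique lie below \<open>h\<close>, the range where \<open>g\<close> is
  known to be increasing, so their order is kept.\<close>

lemma cube_clique_embed:
  assumes "embeds h M g \<phi>" "cube_clique b k h (\<lambda>u v. R (\<phi> u) (\<phi> v)) a lev"
  shows "cube_clique b k M R (\<phi> \<circ> a) (g \<circ> lev)"
proof -
  have "lev x < h" if "x \<in> {1..<k}" for x
  proof -
    have "meets (lev x) (a x) (a (Suc x))" "a x \<in> words h" using assms(2) that by (auto simp: cube_clique_def)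
    thus ?thesis by (auto simp: meets_def words_def)
  qed
  moreover have a: "a x \<in> words h" if "x \<in> {1..k}" for x using assms(2) that by (auto simp: cube_clique_def)
  moreover have "meets (g (lev x)) (\<phi> (a x)) (\<phi> (a (Suc x)))" if "x \<in> {1..<k}" for x
    using assms(2) that by (intro embeds_meets[OF assms(1)] a) (auto simp: cube_clique_def)
  moreover have "\<phi> (a x) \<in> words M" if "x \<in> {1..k}" for x
    using embeds_length[OF assms(1) a[OF that]] .
  moreover have "g i < g j" if "i < j" "j < h" for i j using assms(1) that by (auto simp: embeds_def)
  ultimately show ?thesis using assms(2) unfolding cube_clique_def image_subset_iff comp_def by blast
qed

text \<open>Induction on the set of colours: either the new colour has the clique, or a cube
  avoiding it is coloured by the others. Each colour costs a factor
  \<open>50 * k ^ 4 * (k - 1)\<close> in dimension.\<close>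

lemma monochromatic_cube_clique:
  assumes k: "k \<ge> 2" and inj: "inj_on b {1..<k}" and b: "\<And>x. x \<in> {1..<k} \<Longrightarrow> b x < k - 1"
    and C: "finite C"
    and c: "\<And>u v i. u \<in> words ((50 * k ^ 4 * (k - 1)) ^ card C) \<Longrightarrow>
       v \<in> words ((50 * k ^ 4 * (k - 1)) ^ card C) \<Longrightarrow> meets i u v \<Longrightarrow> c u v \<in> C"
  shows "\<exists>col\<in>C. \<exists>a lev. cube_clique b k ((50 * k ^ 4 * (k - 1)) ^ card C) (\<lambda>u v. c u v = col) a lev"
  using C c
proof (induction C arbitrary: c rule: finite_induct)
  case empty
  \<comment> \<open>Without colours the dimension is still 1, and the one pair of words there cannot
    be coloured.\<close>
  have "[False] \<in> words 1" "[True] \<in> words 1" "meets 0 [False] [True]" by (auto simp: words_def)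
  with empty.prems[of "[False]" "[True]" 0] show ?case by simp
next
  case (insert col C)
  define K where "K = 50 * k ^ 4 * (k - 1)"
  define h where "h = K ^ card C"
  have h: "h \<ge> 1" using k by (auto simp: h_def K_def)
  have M: "K ^ card (insert col C) = K * h" using insert by (simp add: h_def)
  show ?case
  proof (cases "free_cube h (K * h) (\<lambda>u v. c u v = col)")
    case False
    hence "\<exists>a lev. cube_clique b k (K * h) (\<lambda>u v. c u v = col) a lev"
      using clique_or_free_cube[OF k h inj b] unfolding K_def by blast
    thus ?thesis unfolding K_def[symmetric] M by blast
  next
    case True
    then obtain g \<phi> where \<phi>: "embeds h (K * h) g \<phi>"
      and free: "\<And>u v i. u \<in> words h \<Longrightarrow> v \<in> words h \<Longrightarrow> meets i u v \<Longrightarrow> c (\<phi> u) (\<phi> v) \<noteq> col"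
      unfolding free_cube_def by blast
    have "\<exists>col'\<in>C. \<exists>a lev. cube_clique b k ((50 * k ^ 4 * (k - 1)) ^ card C) (\<lambda>u v. c (\<phi> u) (\<phi> v) = col') a lev"
    proof (rule insert.IH)
      fix u v i
      assume "u \<in> words ((50 * k ^ 4 * (k - 1)) ^ card C)"
        "v \<in> words ((50 * k ^ 4 * (k - 1)) ^ card C)" and uv: "meets i u v"
      hence w: "u \<in> words h" "v \<in> words h" by (simp_all add: h_def K_def)
      have "c (\<phi> u) (\<phi> v) \<in> insert col C"
        using insert.prems embeds_length[OF \<phi> w(1)] embeds_length[OF \<phi> w(2)] embeds_meets[OF \<phi> w uv]
        unfolding K_def[symmetric] M by blast
      thus "c (\<phi> u) (\<phi> v) \<in> C" using free[OF w uv] by simp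
    qed
    then obtain col' a lev where col': "col' \<in> C" and cl: "cube_clique b k h (\<lambda>u v. c (\<phi> u) (\<phi> v) = col') a lev"
      unfolding K_def[symmetric] h_def[symmetric] by blast
    have "cube_clique b k (K * h) (\<lambda>u v. c u v = col') (\<phi> \<circ> a) (g \<circ> lev)"
      using cube_clique_embed[OF \<phi>, of b k "\<lambda>u v. c u v = col'" a lev] cl by simp
    thus ?thesis using col' unfolding K_def[symmetric] M by blast
  qed
qed

section \<open>Base 4 codes and the passage to integers\<close>

fun base4 :: "bool list \<Rightarrow> nat" where
  "base4 [] = 0"
| "base4 (b # u) = (if b then 4 ^ length u else 0) + base4 u"

lemma base4_less: "3 * base4 u < 4 ^ length u"
  by (induction u) auto

text \<open>The digit at the first difference contributes \<open>4 ^ (M - Suc i)\<close>, and the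
  tails change this by less than a third of it. Multiplying by 3 avoids fractions. The ranges for
  different \<open>i\<close> are disjoint, so the first difference decides which gap is
  larger.\<close>

lemma base4_meets:
  assumes "meets i u v" "length u = M" "length v = M"
  shows "3 * base4 u + 2 * 4 ^ (M - Suc i) < 3 * base4 v \<and>
         3 * base4 v < 3 * base4 u + 4 * 4 ^ (M - Suc i)"
  using assms
proof (induction i arbitrary: u v M)
  case 0
  then obtain a b u' v' where eq: "u = a # u'" "v = b # v'" by (cases u; cases v) (auto simp: meets_def)
  show ?case using 0 base4_less[of u'] base4_less[of v'] by (auto simp: eq)
next
  case (Suc i)
  then obtain a b u' v' where eq: "u = a # u'" "v = b # v'" by (cases u; cases v) (auto simp: meets_def)
  show ?case using Suc.prems Suc.IH[of u' v' "M - 1"] by (auto simp: eq meets_Suc_Cons)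
qed

lemma base4_gap_less:
  assumes "meets i u v" "meets j x y" "i < j" "u \<in> words M" "v \<in> words M" "x \<in> words M" "y \<in> words M"
  shows "base4 y - base4 x < base4 v - base4 u"
proof -
  have "j < M" using assms by (auto simp: meets_def words_def)
  have "4 * 4 ^ (M - Suc j) = (4::nat) ^ Suc (M - Suc j)" by simp
  also have "\<dots> \<le> 4 ^ (M - Suc i)" using assms(3) \<open>j < M\<close> by (intro power_increasing) auto
  finally have "4 * 4 ^ (M - Suc j) \<le> (4::nat) ^ (M - Suc i)" .
  moreover have "length u = M" "length v = M" "length x = M" "length y = M"
    using assms by (auto simp: words_def)
  ultimately show ?thesis
    using base4_meets[OF assms(1)] base4_meets[OF assms(2)] by fastforce
qed

text \<open>The factor 2 comes from \<open>4 ^ M = 2 ^ (2 * M)\<close>. The constant is absorbed in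
  \<open>k ^ 14\<close>, giving \<open>k ^ 19\<close> per colour, and one more \<open>k ^ q\<close>
  absorbs the 2.\<close>

lemma exponent_bound:
  fixes k q :: nat
  assumes "k \<ge> 2" "q \<ge> 1"
  shows "2 * (50 * k ^ 4 * (k - 1)) ^ q \<le> k ^ (20 * q)"
proof -
  have "50 * k ^ 4 * (k - 1) \<le> 50 * k ^ 4 * k" by (intro mult_left_mono) auto
  also have "\<dots> \<le> 2 ^ 14 * k ^ 5" by (simp add: power_numeral_reduce)
  also have "\<dots> \<le> k ^ 14 * k ^ 5" using assms(1) by (intro mult_right_mono power_mono) auto
  also have "\<dots> = k ^ 19" by (simp add: power_add[symmetric])
  finally have "(50 * k ^ 4 * (k - 1)) ^ q \<le> k ^ (19 * q)" by (simp add: power_mult power_mono)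
  moreover have "2 \<le> k ^ q"
    using assms power_increasing[of 1 q k] by simp
  ultimately have "2 * (50 * k ^ 4 * (k - 1)) ^ q \<le> k ^ q * k ^ (19 * q)" by (intro mult_mono) auto
  also have "\<dots> = k ^ (20 * q)" by (simp add: power_add[symmetric])
  finally show ?thesis .
qed

text \<open>A pair of words receives the colour of the pair of its codes; a monochromatic clique of
  words with levels ordered by \<open>inv \<pi>\<close> then has gaps in the order of
  \<open>\<pi>\<close>.\<close>

lemma gap_ramsey_bound:
  assumes "k > 0" "q > 0" and \<pi>: "\<pi> permutes {1..k-1}"
  shows "gap_ramsey k q \<pi> (2 ^ (k ^ (20 * q)))"
proof (cases "k = 1")
  case True
  \<comment> \<open>A single vertex spans no edge, so colour 1 serves vacuously.\<close>
  have "mono_clique_with_gaps k q \<pi> (2 ^ (k ^ (20 * q))) c (\<lambda>_. 1)" for c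
  proof -
    have "nsets {1::nat} 2 = {}" by (auto simp: nsets_def card_2_iff subset_singleton_iff)
    moreover have "1 \<in> {1..q}" using assms(2) by simp
    ultimately show ?thesis
      using True by (auto simp: mono_clique_with_gaps_def strict_mono_on_def)
  qed
  thus ?thesis unfolding gap_ramsey_def by blast
next
  case False
  hence k: "k \<ge> 2" using assms(1) by simp
  define N :: nat where "N = 2 ^ (k ^ (20 * q))"
  define M where "M = (50 * k ^ 4 * (k - 1)) ^ q"
  \<comment> \<open>The shift by one moves the codes, which start at 0, into
    \<open>{1..N}\<close>.\<close>
  define w where "w u = Suc (base4 u)" for u
  have "(4::nat) ^ M = 2 ^ (2 * M)" by (simp add: power_mult)
  also have "\<dots> \<le> N" unfolding N_def M_def
    using exponent_bound[OF k] assms(2) by (intro power_increasing) auto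
  finally have N: "4 ^ M \<le> N" .
  have w_range: "w u \<in> {1..N}" if "u \<in> words M" for u
    using base4_less[of u] that N by (auto simp: w_def words_def)
  have w_less: "w u < w v" if "u \<in> words M" "v \<in> words M" "meets i u v" for u v i
    using base4_meets[OF that(3), of M] that(1,2) by (auto simp: w_def words_def)
  \<comment> \<open>The rank of gap \<open>x\<close>, counted from 0 to match the block numbers: the
    gap \<open>\<pi> 1\<close>, to be the largest, goes to the first block.\<close>
  define b where "b x = inv \<pi> x - 1" for x
  have inv_in: "inv \<pi> x \<in> {1..k-1}" if "x \<in> {1..<k}" for x
    using permutes_in_image[OF permutes_inv[OF \<pi>], of x] that by simp arith
  have b_less: "b x < k - 1" if "x \<in> {1..<k}" for x using inv_in[OF that] k by (auto simp: b_def)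
  have inj: "inj_on b {1..<k}"
  proof (rule inj_onI)
    fix x y assume xy: "x \<in> {1..<k}" "y \<in> {1..<k}" "b x = b y"
    hence "inv \<pi> x = inv \<pi> y" using inv_in[OF xy(1)] inv_in[OF xy(2)] by (auto simp: b_def)
    thus "x = y" using permutes_inj[OF permutes_inv[OF \<pi>]] by (simp add: inj_eq)
  qed
  show ?thesis unfolding gap_ramsey_def N_def[symmetric]
  proof
    fix c assume c: "c \<in> nsets {1..N} 2 \<rightarrow> {1..q}"
    have "\<exists>col\<in>{1..q}. \<exists>a lev. cube_clique b k ((50 * k ^ 4 * (k - 1)) ^ card {1..q}) (\<lambda>u v. c {w u, w v} = col) a lev"
    proof (rule monochromatic_cube_clique[OF k inj b_less])
      fix u v i assume "u \<in> words ((50 * k ^ 4 * (k - 1)) ^ card {1..q})"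
        "v \<in> words ((50 * k ^ 4 * (k - 1)) ^ card {1..q})" and uv: "meets i u v"
      hence "u \<in> words M" "v \<in> words M" by (simp_all add: M_def)
      hence "{w u, w v} \<in> nsets {1..N} 2"
        using w_range[of u] w_range[of v] w_less[OF _ _ uv] by (auto simp: nsets_def)
      with c show "c {w u, w v} \<in> {1..q}" by auto
    qed auto
    then obtain col a lev where col: "col \<in> {1..q}"
      and cl: "cube_clique b k M (\<lambda>u v. c {w u, w v} = col) a lev" by (auto simp: M_def)
    have a: "a x \<in> words M" if "x \<in> {1..k}" for x using cl that by (auto simp: cube_clique_def)
    have lev: "meets (lev x) (a x) (a (Suc x))" if "x \<in> {1..<k}" for x
      using cl that by (auto simp: cube_clique_def)
    have step: "w (a x) < w (a (Suc x))" if "x \<in> {1..<k}" for x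
      using w_less[OF _ _ lev[OF that]] a that by auto
    have less: "1 \<le> s \<Longrightarrow> t \<le> k \<Longrightarrow> w (a s) < w (a t)" if "s < t" for s t
      using that
    proof (induction s t rule: less_Suc_induct)
      case (1 i)
      thus ?case using step by simp
    qed auto
    have "mono_clique_with_gaps k q \<pi> N c (\<lambda>x. w (a x))"
      unfolding mono_clique_with_gaps_def
    proof (intro conjI bexI[OF _ col] ballI)
      show "(\<lambda>x. w (a x)) ` {1..k} \<subseteq> {1..N}" using a w_range by blast
      show "strict_mono_on {1..k} (\<lambda>x. w (a x))" using less by (auto simp: strict_mono_on_def)
    next
      fix e assume "e \<in> nsets ((\<lambda>x. w (a x)) ` {1..k}) 2"
      then obtain s t where st: "s \<in> {1..k}" "t \<in> {1..k}" "w (a s) \<noteq> w (a t)" "e = {w (a s), w (a t)}"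
        by (auto simp: nsets_def card_2_iff)
      have mono: "c {w (a x), w (a y)} = col" if "1 \<le> x" "x < y" "y \<le> k" for x y
        using cl that by (auto simp: cube_clique_def)
      consider "s < t" | "t < s" using st(3) by fastforce
      thus "c e = col"
        using mono[of s t] mono[of t s] st by cases (auto simp: insert_commute)
    next
      fix i assume i: "i \<in> {1..<k-1}"
      have p: "\<pi> i \<in> {1..<k}" "\<pi> (i + 1) \<in> {1..<k}"
        using permutes_in_image[OF \<pi>, of i] permutes_in_image[OF \<pi>, of "i + 1"] i by auto
      have "b (\<pi> i) < b (\<pi> (i + 1))"
        using i permutes_inverses(2)[OF \<pi>] by (simp add: b_def)
      hence "lev (\<pi> i) < lev (\<pi> (i + 1))" using cl p unfolding cube_clique_def by blast
      from base4_gap_less[OF lev[OF p(1)] lev[OF p(2)] this, of M]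
      show "gap (\<lambda>x. w (a x)) (\<pi> (i + 1)) < gap (\<lambda>x. w (a x)) (\<pi> i)"
        using a p by (auto simp: gap_def w_def)
    qed
    thus "\<exists>a. mono_clique_with_gaps k q \<pi> N c a" by blast
  qed
qed

theorem theorem1p2:
  fixes k q :: nat
  assumes "k > 0" and "q > 0"
  shows "(\<forall>\<pi>. \<pi> permutes {1..k-1} \<longrightarrow> gap_ramsey k q \<pi> (2 ^ (k ^ (20 * q)))) \<and>
         R_max k q \<le> 2 ^ (k ^ (20 * q))"
proof
  show *: "\<forall>\<pi>. \<pi> permutes {1..k-1} \<longrightarrow> gap_ramsey k q \<pi> (2 ^ (k ^ (20 * q)))"
    using gap_ramsey_bound[OF assms] by blast
  have "R_perm \<pi> k q \<le> 2 ^ (k ^ (20 * q))" if "\<pi> permutes {1..k-1}" for \<pi>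
    unfolding R_perm_def using * that by (intro Least_le) auto
  moreover have "finite {\<pi>. \<pi> permutes {1..k-1}}" by (rule finite_permutations) simp
  moreover have "{\<pi>. \<pi> permutes {1..k-1}} \<noteq> {}" using permutes_id by blast
  ultimately show "R_max k q \<le> 2 ^ (k ^ (20 * q))"
    unfolding R_max_def by (subst Max_le_iff) blast+
qed

end
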